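(* The map $\nu_8:\mathrm{Gr}_2(\mathbb{R}^8)\to\mathbb{R}\mathrm{P}^6$, $\langle x,y\rangle\mapsto[\frac12(y\bar x-x\bar y)]$, is a locally trivial fibration with fibre $\mathbb{C}\mathrm{P}^3$.
   Context: $\mathrm{Gr}_2(\mathbb{R}^8)$ is the real Grassmannian of $2$-dimensional linear subspaces of $\mathbb{R}^8$; $\langle x,y\rangle$ is the plane spanned by linearly independent $x,y$. Let $\mathbb{O}\cong\mathbb{R}^8$ be the octonions with canonical basis $e_0,\dots,e_7$, where $e_0$ is the unit, $e_i^2=-e_0$ for $i\ge1$, $e_ie_j=-e_je_i$ for distinct $i,j\geq 1$, and $e_ie_j=e_k$, $e_je_k=e_i$, $e_ke_i=e_j$ for each triple $(i,j,k)\in\{(1,2,3),(1,4,5),(1,7,6),(2,4,6),(2,5,7),(3,4,7),(3,6,5)\}$. The conjugate of $x=\sum x_ie_i$ is $\bar x=x_0e_0-\sum_{i>0}x_ie_i$; the pure octonions ($\bar u=-u$) are identified with $\mathbb{R}^7$. In the formula for $\nu_8$, $x,y\in\mathbb{O}$ and $[u]$ denotes the class in $\mathbb{R}\mathrm{P}^6=(\mathbb{R}^7\setminus\{0\})/(u\sim\lambda u,\ \lambda\in\mathbb{R}\setminus\{0\})$ of the nonzero pure octonion $u$. The map $\nu_8$ is well defined and smooth. *)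

theory Defs
  imports "HOL-Analysis.Analysis"
begin

section \<open>Quotient topologies and locally trivial fibrations\<close>

definition quotient_topology :: "'a topology \<Rightarrow> ('a \<Rightarrow> 'b) \<Rightarrow> 'b topology" where
  "quotient_topology X q =
     topology (\<lambda>U. U \<subseteq> q ` topspace X \<and> openin X {x \<in> topspace X. q x \<in> U})"

lemma openin_quotient_topology:
  "openin (quotient_topology X q) U \<longleftrightarrow>
     U \<subseteq> q ` topspace X \<and> openin X {x \<in> topspace X. q x \<in> U}"
proof -
  have "istopology (\<lambda>U. U \<subseteq> q ` topspace X \<and> openin X {x \<in> topspace X. q x \<in> U})"
  proof -
    have "{x \<in> topspace X. q x \<in> S \<inter> T} =
        {x \<in> topspace X. q x \<in> S} \<inter> {x \<in> topspace X. q x \<in> T}" for S T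
      by auto
    moreover have "{x \<in> topspace X. q x \<in> \<Union>K} = (\<Union>S\<in>K. {x \<in> topspace X. q x \<in> S})" for K
      by auto
    ultimately show ?thesis
      unfolding istopology_def by (auto simp del: Union_iff Int_iff)
  qed
  then show ?thesis
    by (simp add: quotient_topology_def)
qed

lemma topspace_quotient_topology: "topspace (quotient_topology X q) = q ` topspace X"
proof
  show "topspace (quotient_topology X q) \<subseteq> q ` topspace X"
    using openin_topspace[of "quotient_topology X q"] unfolding openin_quotient_topology by simp
  have "{x \<in> topspace X. q x \<in> q ` topspace X} = topspace X"
    by auto
  then have "openin (quotient_topology X q) (q ` topspace X)"
    by (simp add: openin_quotient_topology)
  then show "q ` topspace X \<subseteq> topspace (quotient_topology X q)"
    by (rule openin_subset)
qed

lemma quotient_map_quotient_topology: "quotient_map X (quotient_topology X q) q"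
  by (simp add: quotient_map_def topspace_quotient_topology openin_quotient_topology)

definition locally_trivial_fibration ::
  "'e topology \<Rightarrow> 'b topology \<Rightarrow> ('e \<Rightarrow> 'b) \<Rightarrow> 'f topology \<Rightarrow> bool" where
  "locally_trivial_fibration E B p F \<longleftrightarrow>
     continuous_map E B p \<and>
     (\<forall>b \<in> topspace B. \<exists>U h.
        openin B U \<and> b \<in> U \<and>
        homeomorphic_map (subtopology E {e \<in> topspace E. p e \<in> U})
          (prod_topology (subtopology B U) F) h \<and>
        (\<forall>e \<in> topspace E. p e \<in> U \<longrightarrow> fst (h e) = p e))"

section \<open>Projective spaces and the Grassmannian of planes\<close>

definition proj_class :: "'k::field ^ 'n \<Rightarrow> ('k ^ 'n) set" where
  "proj_class v = {c *s v | c. c \<noteq> 0}"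

lemma proj_class_eq_iff:
  "proj_class u = proj_class v \<longleftrightarrow> (\<exists>c. c \<noteq> 0 \<and> u = c *s v)"
proof
  assume "proj_class u = proj_class v"
  moreover have "1 *s u \<in> proj_class u"
    unfolding proj_class_def using one_neq_zero by blast
  ultimately have "1 *s u \<in> proj_class v"
    by simp
  then show "\<exists>c. c \<noteq> 0 \<and> u = c *s v"
    unfolding proj_class_def by (simp add: conj_commute)
next
  have sub: "proj_class (c *s w) \<subseteq> proj_class w" if "c \<noteq> 0" for c and w :: "'a ^ 'b"
  proof
    fix z assume "z \<in> proj_class (c *s w)"
    then obtain d where "d \<noteq> 0" "z = d *s (c *s w)"
      unfolding proj_class_def by blast
    then have "d * c \<noteq> 0" "z = (d * c) *s w"
      using that by (simp_all only: vector_smult_assoc mult_eq_0_iff simp_thms)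
    then show "z \<in> proj_class w"
      unfolding proj_class_def by blast
  qed
  assume "\<exists>c. c \<noteq> 0 \<and> u = c *s v"
  then obtain c where c: "c \<noteq> 0" "u = c *s v" by blast
  have "inverse c *s u = (inverse c * c) *s v"
    by (simp only: c vector_smult_assoc)
  then have "v = inverse c *s u"
    by (simp only: left_inverse[OF c(1)] vector_smult_lid)
  then show "proj_class u = proj_class v"
    using sub[of c v] sub[of "inverse c" u] c by (metis nonzero_imp_inverse_nonzero subset_antisym)
qed

definition proj_space :: "('k::real_normed_field ^ 'n) set topology" where
  "proj_space = quotient_topology (top_of_set (- {0})) proj_class"

abbreviation RP6 :: "(real ^ 7) set topology" where
  "RP6 \<equiv> proj_space"

abbreviation CP3 :: "(complex ^ 4) set topology" where
  "CP3 \<equiv> proj_space"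

text \<open>The condition \<open>x \<noteq> y\<close> is needed: \<open>independent {x, x}\<close> holds for every nonzero \<open>x\<close>.\<close>

definition lin_indep_pair :: "'a::real_vector \<Rightarrow> 'a \<Rightarrow> bool" where
  "lin_indep_pair x y \<longleftrightarrow> x \<noteq> y \<and> independent {x, y}"

definition Gr2 :: "'a::euclidean_space set topology" where
  "Gr2 = quotient_topology (top_of_set {(x, y). lin_indep_pair x y}) (\<lambda>(x, y). span {x, y})"

lemma topspace_Gr2: "topspace (Gr2 :: 'a::euclidean_space set topology) = {P. subspace P \<and> dim P = 2}"
proof -
  have "\<exists>x y. lin_indep_pair x y \<and> P = span {x, y}"
    if "subspace P" "dim P = 2" for P :: "'a set"
  proof -
    obtain B where B: "B \<subseteq> P" "independent B" "P \<subseteq> span B" "card B = dim P"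
      using basis_exists by blast
    then have "card B = 2"
      using that by simp
    then obtain x y where xy: "B = {x, y}" "x \<noteq> y"
      unfolding card_2_iff by blast
    have "span B = P"
      using B that span_minimal[of B P] by auto
    then show ?thesis
      using B xy unfolding lin_indep_pair_def by blast
  qed
  moreover have "dim {x, y} = 2" if "lin_indep_pair x y" for x y :: 'a
    using that by (simp add: lin_indep_pair_def dim_eq_card_independent)
  ultimately show ?thesis
    unfolding Gr2_def topspace_quotient_topology by (auto simp: image_def)
qed

section \<open>Octonions\<close>

text \<open>Octonions are elements of \<open>real ^ 8\<close>; in the index type \<open>8\<close> the numeral \<open>8\<close> equals \<open>0\<close>, so
  the indices are \<open>0, \<dots>, 7\<close>.\<close>

type_synonym octonion = "real ^ 8"

definition oct_e :: "8 \<Rightarrow> octonion" where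
  "oct_e i = axis i 1"

definition oct_triples :: "(8 \<times> 8 \<times> 8) set" where
  "oct_triples = {(1,2,3), (1,4,5), (1,7,6), (2,4,6), (2,5,7), (3,4,7), (3,6,5)}"

definition oct_cyclic :: "8 \<Rightarrow> 8 \<Rightarrow> 8 \<Rightarrow> bool" where
  "oct_cyclic i j k \<longleftrightarrow>
     (i, j, k) \<in> oct_triples \<or> (j, k, i) \<in> oct_triples \<or> (k, i, j) \<in> oct_triples"

definition oct_basis_mult :: "8 \<Rightarrow> 8 \<Rightarrow> octonion" where
  "oct_basis_mult i j =
     (if i = 0 then oct_e j
      else if j = 0 then oct_e i
      else if i = j then - oct_e 0
      else if \<exists>k. oct_cyclic i j k then oct_e (THE k. oct_cyclic i j k)
      else - oct_e (THE k. oct_cyclic j i k))"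

definition oct_mult :: "octonion \<Rightarrow> octonion \<Rightarrow> octonion" (infixl \<open>\<odot>\<close> 70) where
  "x \<odot> y = (\<Sum>i\<in>UNIV. \<Sum>j\<in>UNIV. (x $ i * y $ j) *\<^sub>R oct_basis_mult i j)"

definition oct_conj :: "octonion \<Rightarrow> octonion" where
  "oct_conj x = (\<chi> i. if i = 0 then x $ 0 else - x $ i)"

text \<open>The identification of the pure octonions with \<open>real ^ 7\<close>.\<close>

definition pure_vec :: "octonion \<Rightarrow> real ^ 7" where
  "pure_vec u = vector [u $ 1, u $ 2, u $ 3, u $ 4, u $ 5, u $ 6, u $ 7]"

lemma UNIV_8: "(UNIV :: 8 set) = {0, 1, 2, 3, 4, 5, 6, 7}"
proof -
  have "card {0, 1, 2, 3, 4, 5, 6, 7 :: 8} = CARD(8)"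
    by simp
  then show ?thesis
    by (metis card_subset_eq finite subset_UNIV)
qed

lemma UNIV_7: "(UNIV :: 7 set) = {1, 2, 3, 4, 5, 6, 7}"
proof -
  have "card {1, 2, 3, 4, 5, 6, 7 :: 7} = CARD(7)"
    by simp
  then show ?thesis
    by (metis card_subset_eq finite subset_UNIV)
qed

lemma oct_e_mult: "oct_e i \<odot> oct_e j = oct_basis_mult i j"
proof -
  have "oct_e i \<odot> oct_e j =
      (\<Sum>k\<in>UNIV. \<Sum>l\<in>UNIV. if k = i then if l = j then oct_basis_mult k l else 0 else 0)"
    unfolding oct_mult_def oct_e_def axis_def by (intro sum.cong refl) auto
  also have "\<dots> = (\<Sum>k\<in>UNIV. if k = i then oct_basis_mult k j else 0)"
    by (intro sum.cong refl) auto
  finally show ?thesis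
    by simp
qed

lemma oct_unit: "oct_e 0 \<odot> oct_e i = oct_e i" "oct_e i \<odot> oct_e 0 = oct_e i"
  by (auto simp: oct_e_mult oct_basis_mult_def)

lemma oct_square: "i \<noteq> 0 \<Longrightarrow> oct_e i \<odot> oct_e i = - oct_e 0"
  by (simp add: oct_e_mult oct_basis_mult_def)

lemma oct_cyclic_unique:
  assumes "oct_cyclic i j k" "oct_cyclic i j l"
  shows "k = l"
proof -
  have "\<forall>(i, j, k) \<in> oct_triples. \<forall>l. (oct_cyclic i j l \<longrightarrow> l = k) \<and>
      (oct_cyclic j k l \<longrightarrow> l = i) \<and> (oct_cyclic k i l \<longrightarrow> l = j)"
    by (simp add: oct_cyclic_def oct_triples_def)
  then show ?thesis
    using assms unfolding oct_cyclic_def[of i j k] by fast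
qed

lemma oct_cyclic_distinct:
  assumes "oct_cyclic i j k"
  shows "i \<noteq> 0" "j \<noteq> 0" "i \<noteq> j" "\<not> oct_cyclic j i l"
proof -
  have "\<forall>(i, j, k) \<in> oct_triples. i \<noteq> 0 \<and> j \<noteq> 0 \<and> k \<noteq> 0 \<and> i \<noteq> j \<and> j \<noteq> k \<and> k \<noteq> i \<and>
     (\<forall>l. \<not> oct_cyclic j i l \<and> \<not> oct_cyclic k j l \<and> \<not> oct_cyclic i k l)"
    by (simp add: oct_cyclic_def oct_triples_def)
  then show "i \<noteq> 0" "j \<noteq> 0" "i \<noteq> j" "\<not> oct_cyclic j i l"
    using assms unfolding oct_cyclic_def[of i j k] by fast+
qed

lemma oct_cyclic_mult:
  assumes "oct_cyclic i j k"
  shows "oct_e i \<odot> oct_e j = oct_e k"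
proof -
  have "(THE l. oct_cyclic i j l) = k"
    using assms oct_cyclic_unique by blast
  then show ?thesis
    using assms oct_cyclic_distinct[OF assms] by (auto simp: oct_e_mult oct_basis_mult_def)
qed

lemma oct_cyclic_total:
  assumes "i \<noteq> 0" "j \<noteq> 0" "i \<noteq> j"
  shows "\<exists>k. oct_cyclic i j k \<or> oct_cyclic j i k"
proof -
  have "\<forall>i\<in>UNIV. \<forall>j\<in>UNIV. i \<noteq> 0 \<longrightarrow> j \<noteq> 0 \<longrightarrow> i \<noteq> j \<longrightarrow> (\<exists>k. oct_cyclic i j k \<or> oct_cyclic j i k)"
    unfolding UNIV_8 by (simp add: oct_cyclic_def oct_triples_def)
  then show ?thesis
    using assms by blast
qed

lemma oct_anticommute:
  assumes "i \<noteq> 0" "j \<noteq> 0" "i \<noteq> j"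
  shows "oct_e i \<odot> oct_e j = - (oct_e j \<odot> oct_e i)"
proof -
  have "(\<exists>k. oct_cyclic i j k) \<longleftrightarrow> \<not> (\<exists>k. oct_cyclic j i k)"
    using oct_cyclic_total[OF assms] oct_cyclic_distinct(4) by blast
  then show ?thesis
    using assms by (auto simp: oct_e_mult oct_basis_mult_def)
qed

lemma bilinear_oct_mult: "bilinear (\<odot>)"
  unfolding bilinear_def linear_iff oct_mult_def
  by (simp add: algebra_simps sum.distrib scaleR_sum_right scaleR_add_left)

lemma linear_oct_conj: "linear oct_conj"
  unfolding linear_iff oct_conj_def by (simp add: vec_eq_iff)

lemma pure_vec_nth:
  "pure_vec u $ 1 = u $ 1" "pure_vec u $ 2 = u $ 2" "pure_vec u $ 3 = u $ 3"
  "pure_vec u $ 4 = u $ 4" "pure_vec u $ 5 = u $ 5" "pure_vec u $ 6 = u $ 6"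
  "pure_vec u $ 7 = u $ 7"
  unfolding pure_vec_def vector_def by simp_all

lemma linear_pure_vec: "linear pure_vec"
proof -
  have "(\<forall>i\<in>UNIV. v $ i = w $ i) \<Longrightarrow> v = w" for v w :: "real ^ 7"
    by (simp add: vec_eq_iff)
  then show ?thesis
    unfolding linear_iff UNIV_7 by (simp add: pure_vec_nth)
qed

section \<open>The map\<close>

definition nu8_rep :: "octonion \<Rightarrow> octonion \<Rightarrow> octonion" where
  "nu8_rep x y = (1/2) *\<^sub>R (y \<odot> oct_conj x - x \<odot> oct_conj y)"

definition nu8 :: "octonion set \<Rightarrow> (real ^ 7) set" where
  "nu8 P = (THE L. \<exists>x y. lin_indep_pair x y \<and> P = span {x, y} \<and>
                     L = proj_class (pure_vec (nu8_rep x y)))"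
lemma nu8_rep_lincomb:
  "nu8_rep (a *\<^sub>R x + b *\<^sub>R y) (c *\<^sub>R x + d *\<^sub>R y) = (a * d - b * c) *\<^sub>R nu8_rep x y"
proof -
  note simps = bilinear_ladd[OF bilinear_oct_mult] bilinear_radd[OF bilinear_oct_mult]
    bilinear_lmul[OF bilinear_oct_mult] bilinear_rmul[OF bilinear_oct_mult]
    linear_add[OF linear_oct_conj] linear_scale[OF linear_oct_conj]
  show ?thesis
    unfolding nu8_rep_def simps by (simp add: vec_eq_iff algebra_simps)
qed

lemma nu8_span:
  assumes "lin_indep_pair x y"
  shows "nu8 (span {x, y}) = proj_class (pure_vec (nu8_rep x y))"
proof -
  have "proj_class (pure_vec (nu8_rep u v)) = proj_class (pure_vec (nu8_rep x y))"
    if uv: "lin_indep_pair u v" and eq: "span {x, y} = span {u, v}" for u v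
  proof -
    have "u \<in> span {x, y}" "v \<in> span {x, y}"
      using eq by (simp_all add: span_base)
    then obtain a b c d where u: "u = a *\<^sub>R x + b *\<^sub>R y" and v: "v = c *\<^sub>R x + d *\<^sub>R y"
      unfolding span_insert span_empty
      by (auto simp: algebra_simps)
    have "a * d - b * c \<noteq> 0"
    proof
      assume 0: "a * d - b * c = 0"
      have nz: "u \<noteq> v" "independent {u, v}"
        using uv by (auto simp: lin_indep_pair_def)
      then have ins: "u \<notin> span {v}" "v \<noteq> 0"
        by (auto simp: independent_insert dependent_zero)
      have *: "p = 0 \<and> q = 0" if "p *\<^sub>R u + q *\<^sub>R v = 0" for p q
      proof -
        have "p = 0"
        proof (rule ccontr)
          assume "p \<noteq> 0"
          then have "u = (- q / p) *\<^sub>R v"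
            using that by (simp add: vec_eq_iff field_simps add_eq_0_iff2)
          then show False
            using ins by (metis span_base span_mul singletonI)
        qed
        then show ?thesis
          using that ins by simp
      qed
      have "d *\<^sub>R u + (- b) *\<^sub>R v = (a * d - b * c) *\<^sub>R x"
        "(- c) *\<^sub>R u + a *\<^sub>R v = (a * d - b * c) *\<^sub>R y"
        by (simp_all add: u v algebra_simps)
      then have "a = 0 \<and> b = 0"
        using 0 *[of d "-b"] *[of "-c" a] by simp
      then have "u = 0"
        by (simp add: u)
      then show False
        using nz dependent_zero by auto
    qed
    then show ?thesis
      unfolding u v nu8_rep_lincomb proj_class_eq_iff linear_scale[OF linear_pure_vec]
      by (intro exI[of _ "a * d - b * c"]) (simp add: scalar_mult_eq_scaleR)
  qed
  then show ?thesis
    unfolding nu8_def using assms by (intro the_equality) blast+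
qed

end

theory Submission
  imports Defs
begin

text \<open>
  If \<open>u\<close> is a pure octonion of norm \<open>1\<close>, then \<open>u (u x) = - x\<close>, so left multiplication by \<open>u\<close> is a
  complex structure on \<open>\<real>\<^sup>8\<close>. From \<open>\<nu>\<^sub>8\<langle>x, y\<rangle> x = \<bar>x\<bar>\<^sup>2 y - (x \<bullet> y) x\<close> one sees that the
  fibre over \<open>[u]\<close> consists of the planes \<open>\<langle>x, u x\<rangle>\<close>, the complex lines for this structure. The
  operator \<open>x \<mapsto> (u + e\<^sub>1) x\<close> intertwines the complex structures of \<open>u\<close> and \<open>e\<^sub>1\<close>, and it is
  invertible when \<open>u \<noteq> - e\<^sub>1\<close>. Over the lines not orthogonal to a given one there is a continuous
  unit representative avoiding \<open>- e\<^sub>1\<close>, and the intertwiners identify all the fibres with the space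
  of complex lines for \<open>e\<^sub>1\<close>, which is \<open>\<complex>P\<^sup>3\<close>.
\<close>

section \<open>Quotient maps and projective spaces\<close>

text \<open>Lets a homeomorphism of quotients be given by formulas on representatives:
  \<open>f\<close> and \<open>g\<close> need to be mutually inverse only up to the identifications.
  By the universal property of quotient maps both \<open>r \<circ> f\<close> and
  \<open>q \<circ> g\<close> descend, and \<open>gf\<close> and \<open>fg\<close> say that the
  descended maps are inverse to each other.\<close>

lemma quotient_maps_homeomorphic:
  assumes q: "quotient_map X X' q" and r: "quotient_map Y Y' r"
    and f: "continuous_map X Y f" and g: "continuous_map Y X g"
    and f_cong: "\<And>a b. a \<in> topspace X \<Longrightarrow> b \<in> topspace X \<Longrightarrow> q a = q b \<Longrightarrow> r (f a) = r (f b)"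
    and g_cong: "\<And>a b. a \<in> topspace Y \<Longrightarrow> b \<in> topspace Y \<Longrightarrow> r a = r b \<Longrightarrow> q (g a) = q (g b)"
    and gf: "\<And>a. a \<in> topspace X \<Longrightarrow> q (g (f a)) = q a"
    and fg: "\<And>b. b \<in> topspace Y \<Longrightarrow> r (f (g b)) = r b"
  obtains h where "homeomorphic_map X' Y' h" "\<And>a. a \<in> topspace X \<Longrightarrow> h (q a) = r (f a)"
proof -
  have rf: "continuous_map X Y' (r \<circ> f)" and qg: "continuous_map Y X' (q \<circ> g)"
    using continuous_map_compose f g quotient_imp_continuous_map q r by blast+
  have rc: "(r \<circ> f) a = (r \<circ> f) b"
    if "a \<in> topspace X" "b \<in> topspace X" "q a = q b" for a b
    using f_cong[OF that] by simp
  have qc: "(q \<circ> g) a = (q \<circ> g) b"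
    if "a \<in> topspace Y" "b \<in> topspace Y" "r a = r b" for a b
    using g_cong[OF that] by simp
  obtain h where h: "continuous_map X' Y' h" "\<And>a. a \<in> topspace X \<Longrightarrow> h (q a) = (r \<circ> f) a"
    by (rule quotient_map_lift_exists[OF q rf rc], assumption+, rule that) simp_all
  obtain k where k: "continuous_map Y' X' k" "\<And>b. b \<in> topspace Y \<Longrightarrow> k (r b) = (q \<circ> g) b"
    by (rule quotient_map_lift_exists[OF r qg qc], assumption+, rule that) simp_all
  have mem: "f a \<in> topspace Y" if "a \<in> topspace X" for a
    using f that by (auto simp: continuous_map_def)
  have mem': "g b \<in> topspace X" if "b \<in> topspace Y" for b
    using g that by (auto simp: continuous_map_def)
  have "homeomorphic_maps X' Y' h k"
    unfolding homeomorphic_maps_def quotient_imp_surjective_map[OF q, symmetric]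
      quotient_imp_surjective_map[OF r, symmetric]
    using h k mem mem' gf fg by auto
  then show ?thesis
    using that[of h] h(2) homeomorphic_map_maps by fastforce
qed

text \<open>A product of quotient maps can fail to be a quotient map, so openness is what gets
  passed to products: around each point an open set contains a box, and boxes go to open
  boxes.\<close>

lemma open_map_prod:
  assumes f: "open_map X X' f" and g: "open_map Y Y' g"
  shows "open_map (prod_topology X Y) (prod_topology X' Y') (\<lambda>(x, y). (f x, g y))"
  unfolding open_map_def
proof (intro allI impI)
  fix W assume W: "openin (prod_topology X Y) W"
  show "openin (prod_topology X' Y') ((\<lambda>(x, y). (f x, g y)) ` W)"
    unfolding openin_prod_topology_alt
  proof (intro allI impI)
    fix a b assume "(a, b) \<in> (\<lambda>(x, y). (f x, g y)) ` W"
    then obtain x y where xy: "(x, y) \<in> W" "a = f x" "b = g y"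
      by auto
    then obtain S T where ST: "openin X S" "openin Y T" "x \<in> S" "y \<in> T" "S \<times> T \<subseteq> W"
      using W[unfolded openin_prod_topology_alt, rule_format, OF xy(1)] by (elim exE conjE)
    have "f ` S \<times> g ` T \<subseteq> (\<lambda>(x, y). (f x, g y)) ` W"
      using ST(5) by force
    moreover have "openin X' (f ` S)" "openin Y' (g ` T)" "a \<in> f ` S" "b \<in> g ` T"
      using ST xy f g by (simp_all add: open_map_def)
    ultimately show "\<exists>S T. openin X' S \<and> openin Y' T \<and> a \<in> S \<and> b \<in> T \<and>
        S \<times> T \<subseteq> (\<lambda>(x, y). (f x, g y)) ` W"
      by blast
  qed
qed

lemma quotient_map_proj_class: "quotient_map (top_of_set (- {0})) proj_space proj_class"
  unfolding proj_space_def by (rule quotient_map_quotient_topology)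

lemma continuous_on_vector_smult:
  fixes c :: "'k::real_normed_field"
  shows "continuous_on UNIV (\<lambda>v :: 'k ^ 'n. c *s v)"
  unfolding vector_scalar_mult_def by (intro continuous_intros)

text \<open>The saturation of an open set is the union of its preimages under all nonzero scalings,
  each of which is continuous.\<close>

lemma open_map_proj_class:
  "open_map (top_of_set (- {0})) proj_space (proj_class :: 'k::real_normed_field ^ 'n \<Rightarrow> _)"
  unfolding open_map_def
proof (intro allI impI)
  fix V :: "('k ^ 'n) set"
  assume "openin (top_of_set (- {0})) V"
  moreover have "open (- {0 :: 'k ^ 'n})"
    by (simp add: open_Compl)
  ultimately have V: "open V" "0 \<notin> V"
    using openin_open_eq by blast+
  have pre: "{x \<in> - {0}. proj_class x \<in> proj_class ` V} = (\<Union>c\<in>- {0}. (\<lambda>v. c *s v) -` V)"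
  proof (intro set_eqI iffI)
    fix x assume "x \<in> {x \<in> - {0}. proj_class x \<in> proj_class ` V}"
    then obtain v c where "v \<in> V" "proj_class v = proj_class x"
      by auto
    then show "x \<in> (\<Union>c\<in>- {0}. (\<lambda>v. c *s v) -` V)"
      unfolding proj_class_eq_iff by auto
  next
    fix x assume "x \<in> (\<Union>c\<in>- {0}. (\<lambda>v. c *s v) -` V)"
    then obtain c where c: "c \<noteq> 0" "c *s x \<in> V"
      by auto
    then have "proj_class (c *s x) = proj_class x"
      unfolding proj_class_eq_iff by blast
    then have "proj_class x \<in> proj_class ` V"
      using c(2) by (metis imageI)
    then show "x \<in> {x \<in> - {0}. proj_class x \<in> proj_class ` V}"
      using c V(2) by auto
  qed
  have "open (\<Union>c\<in>- {0}. (\<lambda>v. c *s v) -` V)"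
    by (intro open_UN ballI open_vimage V(1) continuous_on_vector_smult)
  then have "openin (top_of_set (- {0})) {x \<in> - {0}. proj_class x \<in> proj_class ` V}"
    unfolding pre[symmetric] by (rule open_subset[rotated]) auto
  moreover have "proj_class ` V \<subseteq> proj_class ` (- {0})"
    using V(2) by auto
  ultimately show "openin proj_space (proj_class ` V)"
    unfolding proj_space_def openin_quotient_topology by simp
qed

lemma topspace_proj_space: "topspace proj_space = proj_class ` (- {0})"
  by (simp add: proj_space_def topspace_quotient_topology)

lemma proj_class_scaleR:
  fixes v :: "'k::real_normed_field ^ 'n"
  assumes "c \<noteq> 0"
  shows "proj_class (c *\<^sub>R v) = proj_class v"
proof -
  have "c *\<^sub>R v = of_real c *s v"
    by (simp add: vec_eq_iff) (simp add: scaleR_conv_of_real)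
  then show ?thesis
    using assms unfolding proj_class_eq_iff by (intro exI[of _ "of_real c"]) simp
qed

section \<open>Octonion identities\<close>

lemma sum_8:
  fixes f :: "8 \<Rightarrow> 'a::ab_group_add"
  shows "sum f UNIV = f 0 + f 1 + f 2 + f 3 + f 4 + f 5 + f 6 + f 7"
proof -
  have "sum f {0, 1, 2, 3, 4, 5, 6, 7} = f 0 + f 1 + f 2 + f 3 + f 4 + f 5 + f 6 + f 7"
    by (simp add: add.assoc)
  then show ?thesis
    unfolding UNIV_8 .
qed

lemma octonion_eqI:
  fixes x y :: octonion
  assumes "x $ 0 = y $ 0" "x $ 1 = y $ 1" "x $ 2 = y $ 2" "x $ 3 = y $ 3"
    "x $ 4 = y $ 4" "x $ 5 = y $ 5" "x $ 6 = y $ 6" "x $ 7 = y $ 7"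
  shows "x = y"
proof -
  have "\<forall>i\<in>UNIV. x $ i = y $ i"
    unfolding UNIV_8 using assms by simp
  then show ?thesis
    by (simp add: vec_eq_iff)
qed

lemma oct_inner:
  fixes x y :: octonion
  shows "x \<bullet> y = x$0*y$0 + x$1*y$1 + x$2*y$2 + x$3*y$3 + x$4*y$4 + x$5*y$5 + x$6*y$6 + x$7*y$7"
  unfolding inner_vec_def sum_8 by simp

lemma oct_basis_mult_triple:
  assumes "(i, j, k) \<in> oct_triples"
  shows "oct_basis_mult i j = oct_e k" "oct_basis_mult j k = oct_e i" "oct_basis_mult k i = oct_e j"
    "oct_basis_mult j i = - oct_e k" "oct_basis_mult k j = - oct_e i" "oct_basis_mult i k = - oct_e j"
proof -
  have c: "oct_cyclic i j k" "oct_cyclic j k i" "oct_cyclic k i j"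
    using assms by (simp_all add: oct_cyclic_def)
  have anti: "oct_basis_mult m l = - oct_e n" if "oct_cyclic l m n" for l m n
    using oct_cyclic_mult[OF that] oct_anticommute oct_cyclic_distinct[OF that]
    unfolding oct_e_mult by metis
  show "oct_basis_mult i j = oct_e k" "oct_basis_mult j k = oct_e i" "oct_basis_mult k i = oct_e j"
    using c[THEN oct_cyclic_mult] by (simp_all only: oct_e_mult)
  show "oct_basis_mult j i = - oct_e k" "oct_basis_mult k j = - oct_e i" "oct_basis_mult i k = - oct_e j"
    using c[THEN anti] by simp_all
qed

lemma oct_triples_mem:
  "(1, 2, 3) \<in> oct_triples" "(1, 4, 5) \<in> oct_triples" "(1, 7, 6) \<in> oct_triples"
  "(2, 4, 6) \<in> oct_triples" "(2, 5, 7) \<in> oct_triples" "(3, 4, 7) \<in> oct_triples"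
  "(3, 6, 5) \<in> oct_triples"
  by (simp_all add: oct_triples_def)

lemma oct_e_nth: "oct_e i $ j = (if i = j then 1 else 0)"
  by (auto simp: oct_e_def axis_def)

lemma oct_mult_nth:
  "(x \<odot> y) $ 0 = x$0*y$0 - x$1*y$1 - x$2*y$2 - x$3*y$3 - x$4*y$4 - x$5*y$5 - x$6*y$6 - x$7*y$7"
  "(x \<odot> y) $ 1 = x$0*y$1 + x$1*y$0 + x$2*y$3 - x$3*y$2 + x$4*y$5 - x$5*y$4 + x$7*y$6 - x$6*y$7"
  "(x \<odot> y) $ 2 = x$0*y$2 + x$2*y$0 + x$3*y$1 - x$1*y$3 + x$4*y$6 - x$6*y$4 + x$5*y$7 - x$7*y$5"
  "(x \<odot> y) $ 3 = x$0*y$3 + x$3*y$0 + x$1*y$2 - x$2*y$1 + x$4*y$7 - x$7*y$4 + x$6*y$5 - x$5*y$6"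
  "(x \<odot> y) $ 4 = x$0*y$4 + x$4*y$0 + x$5*y$1 - x$1*y$5 + x$6*y$2 - x$2*y$6 + x$7*y$3 - x$3*y$7"
  "(x \<odot> y) $ 5 = x$0*y$5 + x$5*y$0 + x$1*y$4 - x$4*y$1 + x$7*y$2 - x$2*y$7 + x$3*y$6 - x$6*y$3"
  "(x \<odot> y) $ 6 = x$0*y$6 + x$6*y$0 + x$1*y$7 - x$7*y$1 + x$2*y$4 - x$4*y$2 + x$5*y$3 - x$3*y$5"
  "(x \<odot> y) $ 7 = x$0*y$7 + x$7*y$0 + x$6*y$1 - x$1*y$6 + x$2*y$5 - x$5*y$2 + x$3*y$4 - x$4*y$3"
proof -
  have "oct_basis_mult i 0 = oct_e i" "oct_basis_mult 0 i = oct_e i"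
    "i \<noteq> 0 \<Longrightarrow> oct_basis_mult i i = - oct_e 0" for i
    by (auto simp: oct_basis_mult_def)
  \<comment> \<open>The seven triples with six products each give the 42 products of distinct
    imaginary units; the unit and the squares supply the remaining 22 entries.\<close>
  note table = this oct_triples_mem[THEN oct_basis_mult_triple(1)]
    oct_triples_mem[THEN oct_basis_mult_triple(2)]
    oct_triples_mem[THEN oct_basis_mult_triple(3)]
    oct_triples_mem[THEN oct_basis_mult_triple(4)]
    oct_triples_mem[THEN oct_basis_mult_triple(5)]
    oct_triples_mem[THEN oct_basis_mult_triple(6)]
  have nth: "(x \<odot> y) $ k = (\<Sum>i\<in>UNIV. \<Sum>j\<in>UNIV. x $ i * y $ j * oct_basis_mult i j $ k)" for k
    by (simp add: oct_mult_def)
  show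
  "(x \<odot> y) $ 0 = x$0*y$0 - x$1*y$1 - x$2*y$2 - x$3*y$3 - x$4*y$4 - x$5*y$5 - x$6*y$6 - x$7*y$7"
  "(x \<odot> y) $ 1 = x$0*y$1 + x$1*y$0 + x$2*y$3 - x$3*y$2 + x$4*y$5 - x$5*y$4 + x$7*y$6 - x$6*y$7"
  "(x \<odot> y) $ 2 = x$0*y$2 + x$2*y$0 + x$3*y$1 - x$1*y$3 + x$4*y$6 - x$6*y$4 + x$5*y$7 - x$7*y$5"
  "(x \<odot> y) $ 3 = x$0*y$3 + x$3*y$0 + x$1*y$2 - x$2*y$1 + x$4*y$7 - x$7*y$4 + x$6*y$5 - x$5*y$6"
  "(x \<odot> y) $ 4 = x$0*y$4 + x$4*y$0 + x$5*y$1 - x$1*y$5 + x$6*y$2 - x$2*y$6 + x$7*y$3 - x$3*y$7"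
  "(x \<odot> y) $ 5 = x$0*y$5 + x$5*y$0 + x$1*y$4 - x$4*y$1 + x$7*y$2 - x$2*y$7 + x$3*y$6 - x$6*y$3"
  "(x \<odot> y) $ 6 = x$0*y$6 + x$6*y$0 + x$1*y$7 - x$7*y$1 + x$2*y$4 - x$4*y$2 + x$5*y$3 - x$3*y$5"
  "(x \<odot> y) $ 7 = x$0*y$7 + x$7*y$0 + x$6*y$1 - x$1*y$6 + x$2*y$5 - x$5*y$2 + x$3*y$4 - x$4*y$3"
    unfolding nth sum_8 by (simp_all add: table oct_e_nth)
qed

lemma oct_conj_nth:
  "oct_conj x $ 0 = x $ 0"
  "i \<noteq> 0 \<Longrightarrow> oct_conj x $ i = - x $ i"
  by (simp_all add: oct_conj_def)

lemma nu8_rep_nth_0: "nu8_rep x y $ 0 = 0"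
  by (simp add: nu8_rep_def oct_mult_nth oct_conj_nth)

text \<open>An instance of the alternative law
  \<open>u \<odot> (u \<odot> x) = (u \<odot> u) \<odot> x\<close>, checked in coordinates because
  the product is not associative.\<close>

lemma pure_mult_mult:
  assumes "u $ 0 = 0"
  shows "u \<odot> (u \<odot> x) = - (u \<bullet> u) *\<^sub>R x"
  by (rule octonion_eqI; simp add: oct_mult_nth oct_inner assms algebra_simps)

text \<open>Follows from \<open>(y \<odot> oct_conj x) \<odot> x = (x \<bullet> x) *\<^sub>R
  y\<close>, since \<open>x \<odot> oct_conj y + y \<odot> oct_conj x\<close> is twice the real
  number \<open>x \<bullet> y\<close>. The right-hand side is a vector of the plane orthogonal to
  \<open>x\<close>.\<close>

lemma nu8_rep_mult: "nu8_rep x y \<odot> x = (x \<bullet> x) *\<^sub>R y - (x \<bullet> y) *\<^sub>R x"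
  by (rule octonion_eqI; simp add: nu8_rep_def oct_mult_nth oct_conj_nth oct_inner algebra_simps)

text \<open>Here \<open>(u \<odot> x) \<odot> oct_conj x\<close> is already
  \<open>(x \<bullet> x) *\<^sub>R u\<close>, and the other term is its conjugate, hence its
  negative. For independent \<open>x\<close> and \<open>u \<odot> x\<close> this places their plane
  over the class of \<open>u\<close>.\<close>

lemma nu8_rep_pure_mult:
  assumes "u $ 0 = 0"
  shows "nu8_rep x (u \<odot> x) = (x \<bullet> x) *\<^sub>R u"
  by (rule octonion_eqI; simp add: nu8_rep_def oct_mult_nth oct_conj_nth oct_inner assms algebra_simps)

lemma oct_mult_0 [simp]: "x \<odot> 0 = 0"
  by (rule bilinear_rzero[OF bilinear_oct_mult])

lemmas oct_mult_linear =
  bilinear_ladd[OF bilinear_oct_mult] bilinear_radd[OF bilinear_oct_mult]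
  bilinear_lmul[OF bilinear_oct_mult] bilinear_rmul[OF bilinear_oct_mult]
  bilinear_lneg[OF bilinear_oct_mult] bilinear_rneg[OF bilinear_oct_mult]

section \<open>Planes as complex lines for left multiplication by a unit pure octonion\<close>

lemma unit_pure_mult_mult:
  assumes "s $ 0 = 0" "s \<bullet> s = 1"
  shows "s \<odot> (s \<odot> x) = - x"
  using pure_mult_mult[of s x] assms by simp

lemma span_pair_subset:
  assumes "u \<in> span {x, y}" "v \<in> span {x, y}"
  shows "span {u, v} \<subseteq> span {x, y}"
  by (rule span_minimal) (use assms in auto)

lemma in_span_pair: "a *\<^sub>R x + b *\<^sub>R y \<in> span {x, y}"
  by (intro span_add span_mul span_base) auto

lemma in_span_pair_cases:
  assumes "u \<in> span {x, y}"
  obtains a b where "u = a *\<^sub>R x + b *\<^sub>R y"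
  using assms unfolding span_insert span_empty by (auto simp: algebra_simps)

text \<open>Dependence would give left multiplication by \<open>s\<close> a real eigenvalue
  \<open>k\<close> with \<open>k * k = -1\<close>.\<close>

lemma lin_indep_pair_unit_pure:
  assumes s: "s $ 0 = 0" "s \<bullet> s = 1" and "x \<noteq> 0"
  shows "lin_indep_pair x (s \<odot> x)"
proof -
  have "s \<odot> x \<noteq> k *\<^sub>R x" for k
  proof
    assume k: "s \<odot> x = k *\<^sub>R x"
    then have "- x = (k * k) *\<^sub>R x"
      using unit_pure_mult_mult[OF s, of x] by (simp add: oct_mult_linear)
    then have "(k * k + 1) *\<^sub>R x = 0"
      by (simp add: algebra_simps flip: \<open>- x = (k * k) *\<^sub>R x\<close>)
    then show False
      using \<open>x \<noteq> 0\<close> by (simp add: add_nonneg_eq_0_iff)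
  qed
  from this[of 1] this show ?thesis
    using \<open>x \<noteq> 0\<close>
    by (auto simp: lin_indep_pair_def insert_commute[of x] independent_insert span_singleton)
qed

text \<open>Were it zero, multiplying it by \<open>x\<close> would make \<open>y\<close> a multiple
  of \<open>x\<close>.\<close>

lemma nu8_rep_nonzero:
  assumes "lin_indep_pair x y"
  shows "nu8_rep x y \<noteq> 0"
proof
  assume "nu8_rep x y = 0"
  then have eq: "(x \<bullet> x) *\<^sub>R y = (x \<bullet> y) *\<^sub>R x"
    using nu8_rep_mult[of x y] by (simp add: bilinear_lzero[OF bilinear_oct_mult])
  have ind: "x \<noteq> y" "independent {y, x}"
    using assms by (simp_all add: lin_indep_pair_def insert_commute)
  then have x: "x \<noteq> 0" "y \<notin> span {x}"
    by (auto simp: independent_insert dependent_zero)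
  then have "y = (x \<bullet> y / (x \<bullet> x)) *\<^sub>R x"
    using arg_cong[OF eq, of "\<lambda>v. (1 / (x \<bullet> x)) *\<^sub>R v"] by simp
  then show False
    using x(2) by (metis span_base span_mul singletonI)
qed

text \<open>By \<open>nu8_rep_mult\<close>, \<open>s \<odot> x\<close> is a combination of
  \<open>x\<close> and \<open>y\<close> whose coefficient at \<open>y\<close> is
  \<open>k * (x \<bullet> x)\<close>, nonzero, so \<open>y\<close> can be recovered from
  \<open>x\<close> and \<open>s \<odot> x\<close>.\<close>

lemma span_unit_pure:
  assumes xy: "lin_indep_pair x y" and s: "s = k *\<^sub>R nu8_rep x y" "k \<noteq> 0"
  shows "span {x, s \<odot> x} = span {x, y}"
proof
  have x: "x \<noteq> 0"
    using xy by (auto simp: lin_indep_pair_def dependent_zero)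
  have sx: "s \<odot> x = (- k * (x \<bullet> y)) *\<^sub>R x + (k * (x \<bullet> x)) *\<^sub>R y"
    by (simp add: s oct_mult_linear nu8_rep_mult algebra_simps)
  show "span {x, s \<odot> x} \<subseteq> span {x, y}"
    using span_pair_subset in_span_pair[of _ x _ y] sx by (metis span_base insertI1)
  have "(x \<bullet> y / (x \<bullet> x)) *\<^sub>R x + (1 / (k * (x \<bullet> x))) *\<^sub>R (s \<odot> x) = y"
    using x s(2) unfolding sx by (simp add: scaleR_add_right field_simps)
  then show "span {x, y} \<subseteq> span {x, s \<odot> x}"
    using span_pair_subset in_span_pair[of _ x _ "s \<odot> x"] by (metis span_base insertI1)
qed

text \<open>For the complex structure given by \<open>s\<close>, the plane is the complex line
  through \<open>x\<close>, and \<open>v\<close> is the multiple of \<open>x\<close> by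
  \<open>a + b i\<close>; any nonzero vector of a complex line generates it.\<close>

lemma span_unit_pure_rotate:
  assumes s: "s $ 0 = 0" "s \<bullet> s = 1" and v: "v = a *\<^sub>R x + b *\<^sub>R (s \<odot> x)" "v \<noteq> 0"
  shows "span {v, s \<odot> v} = span {x, s \<odot> x}"
proof
  have sv: "s \<odot> v = (- b) *\<^sub>R x + a *\<^sub>R (s \<odot> x)"
    by (simp add: v oct_mult_linear unit_pure_mult_mult[OF s] algebra_simps)
  show "span {v, s \<odot> v} \<subseteq> span {x, s \<odot> x}"
    using span_pair_subset in_span_pair[of _ x _ "s \<odot> x"] sv v(1) by metis
  \<comment> \<open>The squared modulus of \<open>a + b i\<close>, which is also the determinant of
    the passage from \<open>x, s \<odot> x\<close> to \<open>v, s \<odot> v\<close>; the two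
    combinations below multiply by the conjugate of \<open>a + b i\<close>.\<close>
  define n where "n = a * a + b * b"
  have "n \<noteq> 0"
    using v by (auto simp: n_def add_nonneg_eq_0_iff)
  have "a *\<^sub>R v + (- b) *\<^sub>R (s \<odot> v) = n *\<^sub>R x" "b *\<^sub>R v + a *\<^sub>R (s \<odot> v) = n *\<^sub>R (s \<odot> x)"
    unfolding sv unfolding v(1) n_def by (simp_all add: algebra_simps)
  then have "n *\<^sub>R x \<in> span {v, s \<odot> v}" "n *\<^sub>R (s \<odot> x) \<in> span {v, s \<odot> v}"
    using in_span_pair by metis+
  from this[THEN span_mul, of "inverse n"]
  have "x \<in> span {v, s \<odot> v}" "s \<odot> x \<in> span {v, s \<odot> v}"
    using \<open>n \<noteq> 0\<close> by simp_all
  then show "span {x, s \<odot> x} \<subseteq> span {v, s \<odot> v}"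
    by (rule span_pair_subset)
qed

text \<open>Since \<open>s\<close> and \<open>t\<close> both act with square -1, each side expands
  to \<open>t \<odot> (s \<odot> x) - x\<close>.\<close>

lemma intertwine_left_mult:
  assumes s: "s $ 0 = 0" "s \<bullet> s = 1" and t: "t $ 0 = 0" "t \<bullet> t = 1"
  shows "(s + t) \<odot> (s \<odot> x) = t \<odot> ((s + t) \<odot> x)"
  by (simp add: oct_mult_linear unit_pure_mult_mult[OF s] unit_pure_mult_mult[OF t])

section \<open>Coordinates\<close>

definition pure_oct :: "real ^ 7 \<Rightarrow> octonion" where
  "pure_oct u = u $ 1 *\<^sub>R oct_e 1 + u $ 2 *\<^sub>R oct_e 2 + u $ 3 *\<^sub>R oct_e 3 + u $ 4 *\<^sub>R oct_e 4
    + u $ 5 *\<^sub>R oct_e 5 + u $ 6 *\<^sub>R oct_e 6 + u $ 7 *\<^sub>R oct_e 7"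

lemma pure_oct_nth:
  "pure_oct u $ 0 = 0" "pure_oct u $ 1 = u $ 1" "pure_oct u $ 2 = u $ 2" "pure_oct u $ 3 = u $ 3"
  "pure_oct u $ 4 = u $ 4" "pure_oct u $ 5 = u $ 5" "pure_oct u $ 6 = u $ 6" "pure_oct u $ 7 = u $ 7"
  by (simp_all add: pure_oct_def oct_e_nth)

lemma linear_pure_oct: "linear pure_oct"
  unfolding linear_iff pure_oct_def by (simp add: algebra_simps)

lemma pure_vec_pure_oct: "pure_vec (pure_oct u) = u"
proof -
  have "\<forall>i\<in>UNIV. pure_vec (pure_oct u) $ i = u $ i"
    unfolding UNIV_7 by (simp add: pure_vec_nth pure_oct_nth)
  then show ?thesis
    by (simp add: vec_eq_iff)
qed

lemma pure_oct_pure_vec: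
  assumes "w $ 0 = 0"
  shows "pure_oct (pure_vec w) = w"
  by (rule octonion_eqI) (simp_all add: pure_vec_nth pure_oct_nth assms)

lemma pure_oct_inner: "pure_oct u \<bullet> pure_oct v = u \<bullet> v"
proof -
  have "sum f {1, 2, 3, 4, 5, 6, 7} = f 1 + f 2 + f 3 + f 4 + f 5 + f 6 + f 7" for f :: "7 \<Rightarrow> real"
    by (simp add: add.assoc)
  then show ?thesis
    unfolding oct_inner pure_oct_nth inner_vec_def[of u v] UNIV_7 by simp
qed

text \<open>Complex coordinates for left multiplication by \<open>e\<^sub>1\<close>. The last pair is \<open>(e\<^sub>7, e\<^sub>6)\<close> because
  \<open>e\<^sub>1 e\<^sub>7 = e\<^sub>6\<close>.\<close>

definition oct_of_C4 :: "complex ^ 4 \<Rightarrow> octonion" where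
  "oct_of_C4 z = Re (z $ 1) *\<^sub>R oct_e 0 + Im (z $ 1) *\<^sub>R oct_e 1
    + Re (z $ 2) *\<^sub>R oct_e 2 + Im (z $ 2) *\<^sub>R oct_e 3
    + Re (z $ 3) *\<^sub>R oct_e 4 + Im (z $ 3) *\<^sub>R oct_e 5
    + Re (z $ 4) *\<^sub>R oct_e 7 + Im (z $ 4) *\<^sub>R oct_e 6"

definition C4_of_oct :: "octonion \<Rightarrow> complex ^ 4" where
  "C4_of_oct x = (\<chi> i. if i = 1 then Complex (x $ 0) (x $ 1) else if i = 2 then Complex (x $ 2) (x $ 3)
     else if i = 3 then Complex (x $ 4) (x $ 5) else Complex (x $ 7) (x $ 6))"

lemma oct_of_C4_nth:
  "oct_of_C4 z $ 0 = Re (z $ 1)" "oct_of_C4 z $ 1 = Im (z $ 1)"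
  "oct_of_C4 z $ 2 = Re (z $ 2)" "oct_of_C4 z $ 3 = Im (z $ 2)"
  "oct_of_C4 z $ 4 = Re (z $ 3)" "oct_of_C4 z $ 5 = Im (z $ 3)"
  "oct_of_C4 z $ 7 = Re (z $ 4)" "oct_of_C4 z $ 6 = Im (z $ 4)"
  by (simp_all add: oct_of_C4_def oct_e_nth)

lemma C4_of_oct_nth:
  "C4_of_oct x $ 1 = Complex (x $ 0) (x $ 1)" "C4_of_oct x $ 2 = Complex (x $ 2) (x $ 3)"
  "C4_of_oct x $ 3 = Complex (x $ 4) (x $ 5)" "C4_of_oct x $ 4 = Complex (x $ 7) (x $ 6)"
  by (simp_all add: C4_of_oct_def)

lemma C4_of_oct_of_C4: "C4_of_oct (oct_of_C4 z) = z"
  by (simp add: vec_eq_iff forall_4 C4_of_oct_nth oct_of_C4_nth)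

lemma oct_of_C4_of_oct: "oct_of_C4 (C4_of_oct x) = x"
  by (rule octonion_eqI) (simp_all add: C4_of_oct_nth oct_of_C4_nth)

lemma linear_oct_of_C4: "linear oct_of_C4"
  unfolding linear_iff oct_of_C4_def by (simp add: algebra_simps)

lemma linear_C4_of_oct: "linear C4_of_oct"
  unfolding linear_iff by (simp add: vec_eq_iff forall_4 C4_of_oct_nth complex_eq_iff)

text \<open>Multiplication by the imaginary unit becomes left multiplication by
  \<open>oct_e 1\<close>, so complex lines in \<open>complex ^ 4\<close> correspond to planes stable
  under \<open>oct_e 1\<close>.\<close>

lemma oct_of_C4_smult:
  "oct_of_C4 (c *s z) = Re c *\<^sub>R oct_of_C4 z + Im c *\<^sub>R (oct_e 1 \<odot> oct_of_C4 z)"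
  by (rule octonion_eqI) (simp_all add: oct_of_C4_nth oct_mult_nth oct_e_nth)

lemma C4_of_oct_smult:
  "C4_of_oct (a *\<^sub>R x + b *\<^sub>R (oct_e 1 \<odot> x)) = Complex a b *s C4_of_oct x"
  using arg_cong[OF oct_of_C4_smult[of "Complex a b" "C4_of_oct x"], of C4_of_oct]
  by (simp add: C4_of_oct_of_C4 oct_of_C4_of_oct)

lemma e1_unit_pure: "oct_e 1 $ 0 = 0" "oct_e 1 \<bullet> oct_e 1 = 1"
  by (simp_all add: oct_e_nth oct_inner)

lemma C4_of_oct_eq_0_iff: "C4_of_oct x = 0 \<longleftrightarrow> x = 0"
  using oct_of_C4_of_oct linear_0[OF linear_C4_of_oct] linear_0[OF linear_oct_of_C4] by metis

lemma oct_of_C4_eq_0_iff: "oct_of_C4 z = 0 \<longleftrightarrow> z = 0"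
  using C4_of_oct_of_C4 linear_0[OF linear_C4_of_oct] linear_0[OF linear_oct_of_C4] by metis

section \<open>Local trivialisations\<close>

text \<open>The sign makes this depend only on the line spanned by \<open>u\<close> (off the hyperplane orthogonal to
  \<open>u0\<close>) and keeps it away from \<open>- e\<^sub>1\<close> when \<open>u0 $ 1 \<ge> 0\<close>.\<close>

definition unit_rep :: "real ^ 7 \<Rightarrow> real ^ 7 \<Rightarrow> octonion" where
  "unit_rep u0 u = (sgn (u \<bullet> u0) / norm u) *\<^sub>R pure_oct u"

lemma unit_rep_nth_0: "unit_rep u0 u $ 0 = 0"
  by (simp add: unit_rep_def pure_oct_nth)

lemma unit_rep_inner_self:
  assumes "u \<bullet> u0 \<noteq> 0"
  shows "unit_rep u0 u \<bullet> unit_rep u0 u = 1"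
proof -
  have "norm u \<noteq> 0"
    using assms by auto
  then show ?thesis
    using assms
    by (simp add: unit_rep_def pure_oct_inner sgn_real_def) (simp add: dot_square_norm power2_eq_square)
qed

text \<open>The sign of \<open>c\<close> enters twice, through the vector and through its inner
  product with \<open>u0\<close>, and its absolute value cancels against the norm.\<close>

lemma unit_rep_scaleR:
  assumes "c \<noteq> 0"
  shows "unit_rep u0 (c *\<^sub>R u) = unit_rep u0 u"
  using assms
  by (cases "c > 0") (simp_all add: unit_rep_def linear_scale[OF linear_pure_oct] sgn_mult)

lemma unit_rep_cong:
  assumes "proj_class u = proj_class v"
  shows "unit_rep u0 u = unit_rep u0 v"
  using assms unit_rep_scaleR unfolding proj_class_eq_iff scalar_mult_eq_scaleR by metis

lemma proj_class_unit_rep: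
  assumes "u \<bullet> u0 \<noteq> 0"
  shows "proj_class (pure_vec (unit_rep u0 u)) = proj_class u"
proof -
  have "sgn (u \<bullet> u0) / norm u \<noteq> 0"
    using assms by (auto simp: sgn_zero_iff)
  then show ?thesis
    unfolding unit_rep_def linear_scale[OF linear_pure_vec] pure_vec_pure_oct
    by (rule proj_class_scaleR)
qed

text \<open>Removing the hyperplane orthogonal to \<open>u0\<close> removes both the jump of
  \<open>sgn\<close> and the zero of the norm.\<close>

lemma continuous_on_unit_rep: "continuous_on {u. u \<bullet> u0 \<noteq> 0} (unit_rep u0)"
proof -
  have "bounded_linear pure_oct"
    using linear_pure_oct by (simp add: linear_conv_bounded_linear)
  then show ?thesis
    unfolding unit_rep_def
    by (intro continuous_intros bounded_linear.continuous_on[OF _ continuous_on_id]) auto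
qed

text \<open>The inner product with \<open>u0\<close> tells the two apart: it is positive on the
  representative, but \<open>- u0 $ 1\<close>, hence at most 0, on \<open>- oct_e 1\<close>.\<close>

lemma unit_rep_add_e1:
  assumes u0: "u0 $ 1 \<ge> 0" and u: "u \<bullet> u0 \<noteq> 0"
  shows "unit_rep u0 u + oct_e 1 \<noteq> 0"
proof
  have "unit_rep u0 u \<bullet> pure_oct u0 = \<bar>u \<bullet> u0\<bar> / norm u"
    by (simp add: unit_rep_def pure_oct_inner sgn_real_def)
  also have "\<dots> > 0"
    using u by (intro divide_pos_pos) auto
  finally have "unit_rep u0 u \<bullet> pure_oct u0 > 0" .
  moreover assume "unit_rep u0 u + oct_e 1 = 0"
  then have "unit_rep u0 u = - oct_e 1"
    by (simp add: eq_neg_iff_add_eq_0)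
  ultimately show False
    using u0 by (simp add: oct_inner oct_e_nth pure_oct_nth)
qed

section \<open>Continuity of the map on pairs and on the Grassmannian\<close>

lemma continuous_on_oct_mult:
  assumes "continuous_on S f" "continuous_on S g"
  shows "continuous_on S (\<lambda>x. f x \<odot> g x)"
  using bilinear_oct_mult assms
  by (simp add: bilinear_conv_bounded_bilinear bounded_bilinear.continuous_on)

lemma continuous_on_linear_compose:
  fixes L :: "'a::euclidean_space \<Rightarrow> 'b::real_normed_vector"
  assumes "linear L" "continuous_on S f"
  shows "continuous_on S (\<lambda>x. L (f x))"
  using assms by (simp add: linear_conv_bounded_linear bounded_linear.continuous_on)

lemma continuous_on_nu8_rep:
  assumes "continuous_on S f" "continuous_on S g"
  shows "continuous_on S (\<lambda>p. pure_vec (nu8_rep (f p) (g p)))"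
  unfolding nu8_rep_def
  by (intro continuous_on_linear_compose[OF linear_pure_vec]
      continuous_on_linear_compose[OF linear_oct_conj] continuous_intros
      continuous_on_oct_mult assms)

lemma pure_vec_nu8_rep_nonzero:
  assumes "lin_indep_pair x y"
  shows "pure_vec (nu8_rep x y) \<noteq> 0"
proof
  assume "pure_vec (nu8_rep x y) = 0"
  then have "nu8_rep x y = 0"
    using pure_oct_pure_vec[OF nu8_rep_nth_0, of x y] linear_0[OF linear_pure_oct] by simp
  then show False
    using nu8_rep_nonzero[OF assms] by blast
qed

lemma continuous_map_nu8: "continuous_map Gr2 RP6 nu8"
proof -
  let ?E = "{(x, y). lin_indep_pair x y} :: (octonion \<times> octonion) set"
  have "continuous_on ?E (\<lambda>p. pure_vec (nu8_rep (fst p) (snd p)))"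
    by (intro continuous_on_nu8_rep continuous_intros)
  then have "continuous_map (top_of_set ?E) (top_of_set (- {0})) (\<lambda>p. pure_vec (nu8_rep (fst p) (snd p)))"
    by (auto simp: pure_vec_nu8_rep_nonzero)
  then have "continuous_map (top_of_set ?E) RP6 (proj_class \<circ> (\<lambda>p. pure_vec (nu8_rep (fst p) (snd p))))"
    using quotient_map_proj_class continuous_map_compose quotient_imp_continuous_map by blast
  then have "continuous_map (top_of_set ?E) RP6 (nu8 \<circ> (\<lambda>(x, y). span {x, y}))"
    by (rule continuous_map_eq) (auto simp: nu8_span)
  then show ?thesis
    unfolding Gr2_def by (rule continuous_compose_quotient_map[OF quotient_map_quotient_topology])
qed

text \<open>\<open>U\<close> is the affine chart of lines not orthogonal to \<open>u0\<close>. The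
  trivialisation is built on representatives, between independent pairs over \<open>U\<close>
  (\<open>X\<close>) and pairs of a vector of \<open>A\<close> and a nonzero complex vector
  (\<open>Y\<close>), and then descends through \<open>q\<close> and \<open>r\<close>.\<close>

lemma nu8_local_trivialization:
  assumes u0: "u0 \<noteq> 0" "u0 $ 1 \<ge> 0"
  defines "U \<equiv> proj_class ` {u. u \<bullet> u0 \<noteq> 0}"
  obtains h where "openin RP6 U" "proj_class u0 \<in> U"
    "homeomorphic_map (subtopology Gr2 {P \<in> topspace Gr2. nu8 P \<in> U}) (prod_topology (subtopology RP6 U) CP3) h"
    "\<And>P. P \<in> topspace Gr2 \<Longrightarrow> nu8 P \<in> U \<Longrightarrow> fst (h P) = nu8 P"
proof -
  define E where "E = ({(x, y). lin_indep_pair x y} :: (octonion \<times> octonion) set)"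
  define V where "V = {P \<in> topspace (Gr2 :: octonion set topology). nu8 P \<in> U}"
  define A where "A = {u. u \<bullet> u0 \<noteq> 0}"
  \<comment> \<open>\<open>s u\<close> is the unit representative giving the complex structure over
    the class of \<open>u\<close>; \<open>w u\<close> intertwines it with that of
    \<open>oct_e 1\<close>.\<close>
  define s where "s = unit_rep u0"
  define w where "w = (\<lambda>u. s u + oct_e 1)"
  define nu where "nu = (\<lambda>(x, y). pure_vec (nu8_rep x y))"
  define q where "q = (\<lambda>(x, y). span {x, y} :: octonion set)"
  define r where "r = (\<lambda>(u :: real ^ 7, z :: complex ^ 4). (proj_class u, proj_class z))"
  define X where "X = {p \<in> E. nu p \<in> A}"
  define Y where "Y = A \<times> (- {0 :: complex ^ 4})"
  \<comment> \<open>Only \<open>x\<close> is transported, since \<open>y\<close> can be replaced by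
    \<open>s (nu p) \<odot> x\<close>. The map \<open>g\<close> uses the same \<open>w u\<close>
    because applying it twice is a nonzero real scaling.\<close>
  define f where "f = (\<lambda>p. (nu p, C4_of_oct (w (nu p) \<odot> fst p)))"
  define g where "g = (\<lambda>(u, z). (w u \<odot> oct_of_C4 z, s u \<odot> (w u \<odot> oct_of_C4 z)))"

  have A_open: "open A"
    unfolding A_def by (intro open_Collect_neq continuous_intros)
  have A0: "0 \<notin> A"
    by (simp add: A_def)
  have U: "U = proj_class ` A"
    by (simp add: U_def A_def)
  \<comment> \<open>\<open>A\<close> is saturated: being non-orthogonal to \<open>u0\<close> is
    invariant under nonzero scaling.\<close>
  have mem_U: "proj_class u \<in> U \<longleftrightarrow> u \<in> A" for u
  proof
    assume "proj_class u \<in> U"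
    then obtain v c where "v \<in> A" "u = c *s v" "c \<noteq> 0"
      unfolding U using proj_class_eq_iff by (metis imageE)
    then show "u \<in> A"
      by (simp add: A_def scalar_mult_eq_scaleR)
  qed (simp add: U)
  have "openin (top_of_set (- {0})) A"
    using A_open A0 by (auto intro: open_subset)
  then have U_open: "openin RP6 U"
    using open_map_proj_class unfolding open_map_def U by blast
  have s_pure: "s u $ 0 = 0" for u
    by (simp add: s_def unit_rep_nth_0)
  have s_unit: "s u \<bullet> s u = 1" if "u \<in> A" for u
    using that by (simp add: A_def s_def unit_rep_inner_self)
  have s_cong: "s u = s v" if "proj_class u = proj_class v" for u v
    using that unfolding s_def by (rule unit_rep_cong)
  have proj_s: "proj_class (pure_vec (s u)) = proj_class u" if "u \<in> A" for u
    using that by (simp add: A_def s_def proj_class_unit_rep)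
  have w_nonzero: "w u \<bullet> w u \<noteq> 0" if "u \<in> A" for u
    using that unit_rep_add_e1[OF u0(2)] by (simp add: A_def s_def w_def)
  have ww: "w u \<odot> (w u \<odot> x) = - (w u \<bullet> w u) *\<^sub>R x" for u x
    unfolding w_def by (rule pure_mult_mult) (simp add: s_pure oct_e_nth)
  have w_mult_eq_0: "w u \<odot> x = 0 \<longleftrightarrow> x = 0" if "u \<in> A" for u x
    using ww[of u x] w_nonzero[OF that] by auto
  \<comment> \<open>As \<open>w u\<close> is symmetric in \<open>s u\<close> and
    \<open>oct_e 1\<close>, it intertwines the two structures in both directions.\<close>
  have ws: "w u \<odot> (s u \<odot> x) = oct_e 1 \<odot> (w u \<odot> x)" if "u \<in> A" for u x
    unfolding w_def by (rule intertwine_left_mult[OF s_pure s_unit[OF that] e1_unit_pure])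
  have sw: "s u \<odot> (w u \<odot> x) = w u \<odot> (oct_e 1 \<odot> x)" if "u \<in> A" for u x
    using intertwine_left_mult[OF e1_unit_pure s_pure s_unit[OF that], of x]
    by (simp add: w_def add.commute)

  have span_nu: "span {x, s (nu (x, y)) \<odot> x} = span {x, y}" if "(x, y) \<in> X" for x y
  proof -
    have xy: "lin_indep_pair x y" "nu (x, y) \<bullet> u0 \<noteq> 0"
      using that by (auto simp: X_def E_def A_def)
    have "s (nu (x, y)) = (sgn (nu (x, y) \<bullet> u0) / norm (nu (x, y))) *\<^sub>R nu8_rep x y"
      unfolding s_def unit_rep_def by (simp add: nu_def pure_oct_pure_vec nu8_rep_nth_0)
    then show ?thesis
      by (rule span_unit_pure[OF xy(1)]) (use xy in \<open>auto simp: sgn_zero_iff\<close>)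
  qed
  have nu_section: "(x, s u \<odot> x) \<in> X \<and> proj_class (nu (x, s u \<odot> x)) = proj_class u"
    if "u \<in> A" "x \<noteq> 0" for u x
  proof -
    have "nu (x, s u \<odot> x) = (x \<bullet> x) *\<^sub>R pure_vec (s u)"
      by (simp add: nu_def nu8_rep_pure_mult s_pure linear_scale[OF linear_pure_vec])
    then have "proj_class (nu (x, s u \<odot> x)) = proj_class u"
      using that by (simp add: proj_class_scaleR proj_s)
    then show ?thesis
      using lin_indep_pair_unit_pure[OF s_pure s_unit[OF that(1)] that(2)] that(1)
        mem_U[of u] mem_U[of "nu (x, s u \<odot> x)"]
      unfolding X_def E_def by simp
  qed

  have q_E: "quotient_map (top_of_set E) Gr2 q"
    unfolding Gr2_def E_def q_def by (rule quotient_map_quotient_topology)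
  \<comment> \<open>A quotient map restricts to a quotient map over an open subset of its target,
    and \<open>X\<close> is the preimage of \<open>V\<close> under \<open>q\<close>.\<close>
  have "openin Gr2 V"
    unfolding V_def by (rule openin_continuous_map_preimage[OF continuous_map_nu8 U_open])
  moreover have nu8_q: "nu8 (q p) = proj_class (nu p)" if "p \<in> E" for p
    using that by (auto simp: E_def q_def nu_def nu8_span)
  moreover have "q p \<in> topspace Gr2" if "p \<in> E" for p
    using that quotient_imp_surjective_map[OF q_E] by auto
  ultimately have "quotient_map (subtopology (top_of_set E) X) (subtopology Gr2 V) q"
    by (intro quotient_map_restriction[OF q_E]) (auto simp: X_def V_def mem_U)
  then have q: "quotient_map (top_of_set X) (subtopology Gr2 V) q"
    by (simp add: subtopology_subtopology X_def Int_absorb1 Collect_restrict)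

  have r: "quotient_map (top_of_set Y) (prod_topology (subtopology RP6 U) CP3) r"
  \<comment> \<open>Both factors of \<open>r\<close> are open maps, so their product is open and
    therefore a quotient map.\<close>
  proof (rule continuous_open_imp_quotient_map)
    have A_eq: "{u \<in> topspace (top_of_set (- {0})). proj_class u \<in> U} = A"
      using A0 by (auto simp: mem_U)
    have top_A: "subtopology (top_of_set (- {0})) A = top_of_set A"
      using A0 by (simp add: subtopology_subtopology Int_absorb1)
    have Y: "top_of_set Y = prod_topology (top_of_set A) (top_of_set (- {0}))"
      by (simp add: Y_def)
    have "quotient_map (top_of_set A) (subtopology RP6 U) proj_class"
      using quotient_map_restriction[OF quotient_map_proj_class A_eq] U_open top_A by simp
    then show "continuous_map (top_of_set Y) (prod_topology (subtopology RP6 U) CP3) r"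
      unfolding Y r_def continuous_map_prod_top
      by (simp add: quotient_imp_continuous_map quotient_map_proj_class)
    have "open_map (top_of_set A) (subtopology RP6 U) proj_class"
      using open_map_restriction[OF open_map_proj_class A_eq] top_A by simp
    then show "open_map (top_of_set Y) (prod_topology (subtopology RP6 U) CP3) r"
      unfolding Y r_def by (rule open_map_prod[OF _ open_map_proj_class])
    have "topspace (subtopology RP6 U) = proj_class ` A"
      using openin_subset[OF U_open] U by auto
    then show "r ` topspace (top_of_set Y) = topspace (prod_topology (subtopology RP6 U) CP3)"
      by (auto simp: Y_def r_def topspace_proj_space image_def)
  qed

  have cont_s: "continuous_on A s"
    unfolding A_def s_def by (rule continuous_on_unit_rep)
  have cont_w: "continuous_on A w"
    unfolding w_def by (intro continuous_intros cont_s)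
  have f: "continuous_map (top_of_set X) (top_of_set Y) f"
  proof -
    have nu: "continuous_on X nu"
      unfolding nu_def case_prod_unfold by (intro continuous_on_nu8_rep continuous_intros)
    have "continuous_on X f"
      unfolding f_def
      by (intro continuous_intros nu continuous_on_linear_compose[OF linear_C4_of_oct]
          continuous_on_oct_mult continuous_on_compose2[OF cont_w nu]) (auto simp: X_def)
    moreover have "f p \<in> Y" if "p \<in> X" for p
    proof -
      have "fst p \<noteq> 0" "nu p \<in> A"
        using that by (auto simp: X_def E_def lin_indep_pair_def dependent_zero)
      then show ?thesis
        by (simp add: f_def Y_def C4_of_oct_eq_0_iff w_mult_eq_0)
    qed
    ultimately show ?thesis
      by auto
  qed
  have g_mem: "g (u, z) \<in> X \<and> proj_class (nu (g (u, z))) = proj_class u" if "(u, z) \<in> Y" for u z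
    using that nu_section[of u "w u \<odot> oct_of_C4 z"]
    by (simp add: g_def Y_def w_mult_eq_0 oct_of_C4_eq_0_iff)
  have g: "continuous_map (top_of_set Y) (top_of_set X) g"
  proof -
    have "continuous_on Y (\<lambda>p. s (fst p))" "continuous_on Y (\<lambda>p. w (fst p))"
      by (auto simp: Y_def intro!: continuous_on_compose2[OF cont_s] continuous_on_compose2[OF cont_w]
          continuous_intros)
    then have "continuous_on Y g"
      unfolding g_def case_prod_unfold
      by (intro continuous_intros continuous_on_linear_compose[OF linear_oct_of_C4] continuous_on_oct_mult)
    then show ?thesis
      using g_mem by auto
  qed

  have f_cong: "r (f p) = r (f p')" if p: "p \<in> X" "p' \<in> X" "q p = q p'" for p p'
  proof -
    obtain x y x' y' where xy: "p = (x, y)" "p' = (x', y')"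
      by (metis surj_pair)
    have nu_eq: "proj_class (nu p) = proj_class (nu p')"
      using p nu8_q unfolding X_def by (metis (no_types, lifting) mem_Collect_eq)
    then have s: "s (nu p) = s (nu p')"
      by (rule s_cong)
    have A: "nu p \<in> A"
      using p by (simp add: X_def)
    \<comment> \<open>Two bases of one plane share the same \<open>s\<close>, so \<open>x'\<close>
      is a complex multiple of \<open>x\<close>; \<open>ws\<close> carries the same factor
      \<open>Complex a b\<close> over to the coordinates.\<close>
    have "x' \<in> span {x, s (nu p) \<odot> x}"
      using p span_nu[of x y] unfolding xy q_def by (simp add: span_base)
    then obtain a b where x': "x' = a *\<^sub>R x + b *\<^sub>R (s (nu p) \<odot> x)"
      by (rule in_span_pair_cases)
    have "x' \<noteq> 0"
      using p xy by (auto simp: X_def E_def lin_indep_pair_def dependent_zero)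
    then have ab: "Complex a b \<noteq> 0"
      using x' by (auto simp: complex_eq_iff)
    have "C4_of_oct (w (nu p) \<odot> x') = Complex a b *s C4_of_oct (w (nu p) \<odot> x)"
      unfolding x' oct_mult_linear ws[OF A] by (rule C4_of_oct_smult)
    then have "proj_class (C4_of_oct (w (nu p) \<odot> x')) = proj_class (C4_of_oct (w (nu p) \<odot> x))"
      unfolding proj_class_eq_iff using ab by blast
    moreover have "w (nu p') = w (nu p)"
      by (simp add: w_def s)
    ultimately show ?thesis
      using nu_eq by (simp add: r_def f_def xy)
  qed
  have g_cong: "q (g p) = q (g p')" if p: "p \<in> Y" "p' \<in> Y" "r p = r p'" for p p'
  proof -
    obtain u z u' z' where uz: "p = (u, z)" "p' = (u', z')"
      by (metis surj_pair)
    have eq: "proj_class u = proj_class u'" "proj_class z' = proj_class z"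
      using p uz by (simp_all add: r_def)
    have A: "u \<in> A" "z' \<noteq> 0"
      using p uz by (simp_all add: Y_def)
    have s: "s u' = s u" "w u' = w u"
      using s_cong[OF eq(1)] by (simp_all add: w_def)
    obtain c where c: "z' = c *s z"
      using eq(2) unfolding proj_class_eq_iff by blast
    \<comment> \<open>\<open>sw\<close> turns the complex factor \<open>c\<close> into its action
      through \<open>s u\<close>, so both vectors lie on one complex line for
      \<open>s u\<close>.\<close>
    have "w u \<odot> oct_of_C4 z' =
        Re c *\<^sub>R (w u \<odot> oct_of_C4 z) + Im c *\<^sub>R (s u \<odot> (w u \<odot> oct_of_C4 z))"
      by (simp add: c oct_of_C4_smult oct_mult_linear sw[OF A(1)])
    moreover have "w u \<odot> oct_of_C4 z' \<noteq> 0"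
      using A by (simp add: w_mult_eq_0 oct_of_C4_eq_0_iff)
    ultimately have "span {w u \<odot> oct_of_C4 z', s u \<odot> (w u \<odot> oct_of_C4 z')} =
        span {w u \<odot> oct_of_C4 z, s u \<odot> (w u \<odot> oct_of_C4 z)}"
      by (rule span_unit_pure_rotate[OF s_pure s_unit[OF A(1)]])
    then show ?thesis
      by (simp add: q_def g_def uz s)
  qed
  have gf: "q (g (f p)) = q p" if p: "p \<in> X" for p
  proof -
    obtain x y where xy: "p = (x, y)"
      by (metis surj_pair)
    \<comment> \<open>The factor from \<open>ww\<close>: the round trip scales \<open>x\<close> by
      \<open>k\<close> and replaces the second vector by its image under \<open>s (nu p)\<close>,
      neither of which changes the plane.\<close>
    define k where "k = - (w (nu p) \<bullet> w (nu p))"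
    have A: "nu p \<in> A"
      using p by (simp add: X_def)
    then have k: "k \<noteq> 0"
      using w_nonzero by (simp add: k_def)
    have x: "x \<noteq> 0"
      using p xy by (auto simp: X_def E_def lin_indep_pair_def dependent_zero)
    have "g (f p) = (k *\<^sub>R x, s (nu p) \<odot> (k *\<^sub>R x))"
      by (simp add: g_def f_def oct_of_C4_of_oct ww k_def xy)
    then have "q (g (f p)) = span {k *\<^sub>R x, s (nu p) \<odot> (k *\<^sub>R x)}"
      by (simp add: q_def)
    also have "\<dots> = span {x, s (nu p) \<odot> x}"
      using k x by (intro span_unit_pure_rotate[OF s_pure s_unit[OF A], of _ k _ 0]) simp_all
    also have "\<dots> = q p"
      using span_nu p by (simp add: xy q_def)
    finally show ?thesis .
  qed
  have fg: "r (f (g p)) = r p" if p: "p \<in> Y" for p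
  proof -
    obtain u z where uz: "p = (u, z)"
      by (metis surj_pair)
    have A: "u \<in> A"
      using p by (simp add: Y_def uz)
    have eq: "proj_class (nu (g (u, z))) = proj_class u"
      using g_mem p uz by blast
    \<comment> \<open>\<open>nu (g (u, z))\<close> may differ from \<open>u\<close> by a scalar, but
      \<open>s\<close> and \<open>w\<close> depend only on the class.\<close>
    have "w (nu (g (u, z))) = w u"
      using s_cong[OF eq] by (simp add: w_def)
    then have "f (g p) = (nu (g (u, z)), C4_of_oct (w u \<odot> (w u \<odot> oct_of_C4 z)))"
      by (simp add: f_def uz g_def)
    also have "C4_of_oct (w u \<odot> (w u \<odot> oct_of_C4 z)) = (- (w u \<bullet> w u)) *\<^sub>R z"
      unfolding ww linear_scale[OF linear_C4_of_oct] C4_of_oct_of_C4 ..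
    finally show ?thesis
      using eq w_nonzero[OF A] by (simp add: r_def uz proj_class_scaleR del: scaleR_minus_left)
  qed

  obtain h where h: "homeomorphic_map (subtopology Gr2 V) (prod_topology (subtopology RP6 U) CP3) h"
    "\<And>p. p \<in> X \<Longrightarrow> h (q p) = r (f p)"
    by (rule quotient_maps_homeomorphic[OF q r f g], unfold topspace_euclidean_subtopology,
        rule f_cong, assumption+, rule g_cong, assumption+, rule gf, assumption, rule fg, assumption)
      blast
  have "fst (h P) = nu8 P" if "P \<in> topspace Gr2" "nu8 P \<in> U" for P
  proof -
    have "P \<in> topspace (subtopology Gr2 V)"
      using that by (simp add: V_def)
    then obtain p where p: "p \<in> X" "P = q p"
      unfolding quotient_imp_surjective_map[OF q, symmetric] by auto
    then have "h P = r (f p)" "nu8 P = proj_class (nu p)"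
      using h(2) nu8_q by (auto simp: X_def)
    then show ?thesis
      by (simp add: r_def f_def)
  qed
  moreover have "proj_class u0 \<in> U"
    using u0(1) by (simp add: mem_U A_def)
  ultimately show ?thesis
    using that U_open h(1) unfolding V_def by blast
qed

theorem proposition4p10:
  shows "locally_trivial_fibration (Gr2 :: octonion set topology) RP6 nu8 CP3"
  unfolding locally_trivial_fibration_def
proof (intro conjI ballI)
  show "continuous_map (Gr2 :: octonion set topology) RP6 nu8"
    by (rule continuous_map_nu8)
next
  fix b assume "b \<in> topspace RP6"
  then obtain v where v: "v \<noteq> 0" "b = proj_class v"
    by (auto simp: topspace_proj_space)
  \<comment> \<open>Both signs represent \<open>b\<close>, so the one with nonnegative first
    coordinate can be chosen, which keeps the unit representatives away from
    \<open>- oct_e 1\<close>.\<close>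
  define u0 where "u0 = (if v $ 1 \<ge> 0 then v else - v)"
  have b: "b = proj_class u0"
    using proj_class_scaleR[of "-1" v] by (simp add: v u0_def)
  have "u0 \<noteq> 0" "u0 $ 1 \<ge> 0"
    using v by (auto simp: u0_def)
  then obtain h where "openin RP6 (proj_class ` {u. u \<bullet> u0 \<noteq> 0})"
    "b \<in> proj_class ` {u. u \<bullet> u0 \<noteq> 0}"
    "homeomorphic_map (subtopology Gr2 {P \<in> topspace Gr2. nu8 P \<in> proj_class ` {u. u \<bullet> u0 \<noteq> 0}})
      (prod_topology (subtopology RP6 (proj_class ` {u. u \<bullet> u0 \<noteq> 0})) CP3) h"
    "\<And>P. P \<in> topspace Gr2 \<Longrightarrow> nu8 P \<in> proj_class ` {u. u \<bullet> u0 \<noteq> 0} \<Longrightarrow> fst (h P) = nu8 P"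
    unfolding b by (rule nu8_local_trivialization) blast
  then show "\<exists>U h. openin RP6 U \<and> b \<in> U \<and>
      homeomorphic_map (subtopology Gr2 {P \<in> topspace Gr2. nu8 P \<in> U})
        (prod_topology (subtopology RP6 U) CP3) h \<and>
      (\<forall>P \<in> topspace Gr2. nu8 P \<in> U \<longrightarrow> fst (h P) = nu8 P)"
    by blast
qed

end
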